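(* Let $(T,\mu,\eta)$ be an ordered saturation monad on $\mathsf{C}$ such that every hom-set of $\mathcal{K}l(T)$ has finite joins, and such that for all $\alpha:X\rightsquigarrow X$, all $f:X\rightsquigarrow Y$ in $\mathcal{K}l(T)$ and all $\beta:Y\rightsquigarrow Y$: $f\cdot\alpha\le\beta\cdot f$ implies $f\cdot\alpha^*\le\beta^*\cdot f$, and $f\cdot\alpha\ge\beta\cdot f$ implies $f\cdot\alpha^*\ge\beta^*\cdot f$. Then for every $\alpha:X\rightsquigarrow X$, $\alpha^*$ is the least fixed point of the map $x\mapsto 1_X\vee x\cdot\alpha$ on $Hom_{\mathcal{K}l(T)}(X,X)$; that is, $\alpha^*=1_X\vee\alpha^*\cdot\alpha$ and $\alpha^*\le\gamma$ for every $\gamma$ with $\gamma=1_X\vee\gamma\cdot\alpha$.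
   Context: Kleisli category $\mathcal{K}l(T)$: morphisms $X\rightsquigarrow Y$ are morphisms $X\to TY$, composition $g\cdot f=\mu_Z\circ Tg\circ f$, identity $1_X=\eta_X$; $f^\sharp=\eta_Y\circ f$ for $f$ in $\mathsf{C}$. Order enriched: hom-sets are posets and composition is monotone. Ordered saturation monad: $\mathcal{K}l(T)$ order enriched and for each $\alpha:X\rightsquigarrow X$ there is $\alpha^*$ with (1) $1\le\alpha^*$; (2) $\alpha\le\alpha^*$; (3) $\alpha^*\cdot\alpha^*\le\alpha^*$; (4) $\alpha^*\le\beta$ whenever $1\le\beta$, $\alpha\le\beta$, $\beta\cdot\beta\le\beta$; (5) for $f:X\to Y$ in $\mathsf{C}$ and $\beta:Y\rightsquigarrow Y$, $f^\sharp\cdot\alpha\le\beta\cdot f^\sharp\Rightarrow f^\sharp\cdot\alpha^*\le\beta^*\cdot f^\sharp$, and likewise with $\ge$. *)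

theory Defs
  imports "HOL-Algebra.Complete_Lattice"
begin

record ('o, 'a) cat_data =
  Obj :: "'o set"
  Arr :: "'a set"
  Dom :: "'a \<Rightarrow> 'o"
  Cod :: "'a \<Rightarrow> 'o"
  Id :: "'o \<Rightarrow> 'a"
  Comp :: "'a \<Rightarrow> 'a \<Rightarrow> 'a"

definition Hom :: "('o, 'a) cat_data \<Rightarrow> 'o \<Rightarrow> 'o \<Rightarrow> 'a set"
  where "Hom C X Y = {f \<in> Arr C. Dom C f = X \<and> Cod C f = Y}"

locale category =
  fixes C :: "('o, 'a) cat_data"
  assumes Dom_Obj: "f \<in> Arr C \<Longrightarrow> Dom C f \<in> Obj C"
    and Cod_Obj: "f \<in> Arr C \<Longrightarrow> Cod C f \<in> Obj C"
    and Id_Hom: "X \<in> Obj C \<Longrightarrow> Id C X \<in> Hom C X X"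
    and Comp_Hom: "\<lbrakk>f \<in> Hom C X Y; g \<in> Hom C Y Z\<rbrakk> \<Longrightarrow> Comp C g f \<in> Hom C X Z"
    and Comp_Id: "f \<in> Hom C X Y \<Longrightarrow> Comp C f (Id C X) = f"
    and Id_Comp: "f \<in> Hom C X Y \<Longrightarrow> Comp C (Id C Y) f = f"
    and Comp_assoc: "\<lbrakk>f \<in> Hom C W X; g \<in> Hom C X Y; h \<in> Hom C Y Z\<rbrakk>
          \<Longrightarrow> Comp C (Comp C h g) f = Comp C h (Comp C g f)"

record ('o, 'a) monad_data =
  FObj :: "'o \<Rightarrow> 'o"
  FArr :: "'a \<Rightarrow> 'a"
  Unit :: "'o \<Rightarrow> 'a"
  Mult :: "'o \<Rightarrow> 'a"

locale monad = category C for C :: "('o, 'a) cat_data" +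
  fixes T :: "('o, 'a) monad_data"
  assumes FObj_Obj: "X \<in> Obj C \<Longrightarrow> FObj T X \<in> Obj C"
    and FArr_Hom: "f \<in> Hom C X Y \<Longrightarrow> FArr T f \<in> Hom C (FObj T X) (FObj T Y)"
    and FArr_Id: "X \<in> Obj C \<Longrightarrow> FArr T (Id C X) = Id C (FObj T X)"
    and FArr_Comp: "\<lbrakk>f \<in> Hom C X Y; g \<in> Hom C Y Z\<rbrakk>
          \<Longrightarrow> FArr T (Comp C g f) = Comp C (FArr T g) (FArr T f)"
    and Unit_Hom: "X \<in> Obj C \<Longrightarrow> Unit T X \<in> Hom C X (FObj T X)"
    and Mult_Hom: "X \<in> Obj C \<Longrightarrow> Mult T X \<in> Hom C (FObj T (FObj T X)) (FObj T X)"
    and Unit_natural: "f \<in> Hom C X Y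
          \<Longrightarrow> Comp C (Unit T Y) f = Comp C (FArr T f) (Unit T X)"
    and Mult_natural: "f \<in> Hom C X Y
          \<Longrightarrow> Comp C (Mult T Y) (FArr T (FArr T f)) = Comp C (FArr T f) (Mult T X)"
    and Mult_FArr_Unit: "X \<in> Obj C
          \<Longrightarrow> Comp C (Mult T X) (FArr T (Unit T X)) = Id C (FObj T X)"
    and Mult_Unit: "X \<in> Obj C
          \<Longrightarrow> Comp C (Mult T X) (Unit T (FObj T X)) = Id C (FObj T X)"
    and Mult_assoc: "X \<in> Obj C
          \<Longrightarrow> Comp C (Mult T X) (FArr T (Mult T X)) = Comp C (Mult T X) (Mult T (FObj T X))"

definition kl_Hom :: "('o, 'a) cat_data \<Rightarrow> ('o, 'a) monad_data \<Rightarrow> 'o \<Rightarrow> 'o \<Rightarrow> 'a set"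
  where "kl_Hom C T X Y = Hom C X (FObj T Y)"

text \<open>The codomain \<open>Z\<close> of the second arrow is an explicit argument, because it cannot be
  recovered from the object \<open>FObj T Z\<close> when the functor is not injective on objects.\<close>

definition kl_comp ::
    "('o, 'a) cat_data \<Rightarrow> ('o, 'a) monad_data \<Rightarrow> 'o \<Rightarrow> 'a \<Rightarrow> 'a \<Rightarrow> 'a"
  where "kl_comp C T Z g f = Comp C (Mult T Z) (Comp C (FArr T g) f)"

definition kl_id :: "('o, 'a) monad_data \<Rightarrow> 'o \<Rightarrow> 'a"
  where "kl_id T X = Unit T X"

definition sharp ::
    "('o, 'a) cat_data \<Rightarrow> ('o, 'a) monad_data \<Rightarrow> 'o \<Rightarrow> 'a \<Rightarrow> 'a"
  where "sharp C T Y f = Comp C (Unit T Y) f"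

context monad
begin

lemma kl_id_Hom: "X \<in> Obj C \<Longrightarrow> kl_id T X \<in> kl_Hom C T X X"
  by (simp add: kl_id_def kl_Hom_def Unit_Hom)

lemma kl_comp_Hom:
  assumes "Z \<in> Obj C" "f \<in> kl_Hom C T X Y" "g \<in> kl_Hom C T Y Z"
  shows "kl_comp C T Z g f \<in> kl_Hom C T X Z"
  using assms unfolding kl_comp_def kl_Hom_def by (blast intro: Comp_Hom FArr_Hom Mult_Hom)

lemma kl_comp_id:
  assumes "X \<in> Obj C" "Y \<in> Obj C" "f \<in> kl_Hom C T X Y"
  shows "kl_comp C T Y f (kl_id T X) = f"
proof -
  have f: "f \<in> Hom C X (FObj T Y)" using assms by (simp add: kl_Hom_def)
  have "Comp C (Mult T Y) (Comp C (Unit T (FObj T Y)) f)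
      = Comp C (Comp C (Mult T Y) (Unit T (FObj T Y))) f"
    using Comp_assoc[OF f Unit_Hom Mult_Hom] assms FObj_Obj by simp
  then show ?thesis
    using f assms by (simp add: kl_comp_def kl_id_def Unit_natural[OF f, symmetric] Mult_Unit Id_Comp)
qed

lemma kl_id_comp:
  assumes "X \<in> Obj C" "Y \<in> Obj C" "f \<in> kl_Hom C T X Y"
  shows "kl_comp C T Y (kl_id T Y) f = f"
proof -
  have f: "f \<in> Hom C X (FObj T Y)" using assms by (simp add: kl_Hom_def)
  have "Comp C (Mult T Y) (Comp C (FArr T (Unit T Y)) f)
      = Comp C (Comp C (Mult T Y) (FArr T (Unit T Y))) f"
    using Comp_assoc[OF f FArr_Hom[OF Unit_Hom] Mult_Hom] assms by simp
  then show ?thesis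
    using f assms by (simp add: kl_comp_def kl_id_def Mult_FArr_Unit Id_Comp)
qed

lemma kl_comp_assoc:
  assumes "Y \<in> Obj C" "Z \<in> Obj C"
    and "f \<in> kl_Hom C T W X" "g \<in> kl_Hom C T X Y" "h \<in> kl_Hom C T Y Z"
  shows "kl_comp C T Z (kl_comp C T Z h g) f = kl_comp C T Z h (kl_comp C T Y g f)"
proof -
  let ?c = "Comp C" and ?F = "FArr T" and ?m = "Mult T"
  have f: "f \<in> Hom C W (FObj T X)" and g: "g \<in> Hom C X (FObj T Y)"
    and h: "h \<in> Hom C Y (FObj T Z)" using assms by (simp_all add: kl_Hom_def)
  have TZ: "FObj T Z \<in> Obj C" using assms FObj_Obj by blast
  note Fg = FArr_Hom[OF g] and Fh = FArr_Hom[OF h]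
  note FFh = FArr_Hom[OF Fh] and mY = Mult_Hom[OF assms(1)] and mZ = Mult_Hom[OF assms(2)]
  note FmZ = FArr_Hom[OF mZ] and mTZ = Mult_Hom[OF TZ]
  note Fgf = Comp_Hom[OF f Fg]
  have "?F (?c (?m Z) (?c (?F h) g)) = ?c (?F (?m Z)) (?c (?F (?F h)) (?F g))"
    using FArr_Comp[OF Comp_Hom[OF g Fh] mZ] FArr_Comp[OF g Fh] by simp
  then have "?c (?F (?c (?m Z) (?c (?F h) g))) f = ?c (?F (?m Z)) (?c (?F (?F h)) (?c (?F g) f))"
    using Comp_assoc[OF f Comp_Hom[OF Fg FFh] FmZ] Comp_assoc[OF f Fg FFh] by simp
  then have "?c (?m Z) (?c (?F (?c (?m Z) (?c (?F h) g))) f)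
      = ?c (?c (?m Z) (?m (FObj T Z))) (?c (?F (?F h)) (?c (?F g) f))"
    using Comp_assoc[OF Comp_Hom[OF Fgf FFh] FmZ mZ] Mult_assoc[OF assms(2)] by simp
  also have "\<dots> = ?c (?m Z) (?c (?c (?m (FObj T Z)) (?F (?F h))) (?c (?F g) f))"
    using Comp_assoc[OF Comp_Hom[OF Fgf FFh] mTZ mZ] Comp_assoc[OF Fgf FFh mTZ] by simp
  also have "\<dots> = ?c (?m Z) (?c (?F h) (?c (?m Y) (?c (?F g) f)))"
    using Mult_natural[OF h] Comp_assoc[OF Fgf mY Fh] by simp
  finally show ?thesis by (simp add: kl_comp_def)
qed

end

text \<open>\<open>K X Y\<close> is the Kleisli hom-set from \<open>X\<close> to \<open>Y\<close> together with its order.\<close>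

locale order_enriched_monad = monad C T
  for C :: "('o, 'a) cat_data" and T :: "('o, 'a) monad_data" +
  fixes K :: "'o \<Rightarrow> 'o \<Rightarrow> 'a gorder"
  assumes K_carrier: "\<lbrakk>X \<in> Obj C; Y \<in> Obj C\<rbrakk> \<Longrightarrow> carrier (K X Y) = kl_Hom C T X Y"
    and K_partial_order: "\<lbrakk>X \<in> Obj C; Y \<in> Obj C\<rbrakk> \<Longrightarrow> partial_order (K X Y)"
    and kl_comp_mono: "\<lbrakk>X \<in> Obj C; Y \<in> Obj C; Z \<in> Obj C;
          f \<in> kl_Hom C T X Y; f' \<in> kl_Hom C T X Y; g \<in> kl_Hom C T Y Z; g' \<in> kl_Hom C T Y Z;
          f \<sqsubseteq>\<^bsub>K X Y\<^esub> f'; g \<sqsubseteq>\<^bsub>K Y Z\<^esub> g'\<rbrakk>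
          \<Longrightarrow> kl_comp C T Z g f \<sqsubseteq>\<^bsub>K X Z\<^esub> kl_comp C T Z g' f'"

text \<open>\<open>star X \<alpha>\<close> is \<open>\<alpha>\<^sup>*\<close> for \<open>\<alpha>\<close> in \<open>K X X\<close>; the first five axioms determine it uniquely.\<close>

locale ordered_saturation_monad = order_enriched_monad C T K
  for C :: "('o, 'a) cat_data" and T :: "('o, 'a) monad_data" and K :: "'o \<Rightarrow> 'o \<Rightarrow> 'a gorder" +
  fixes star :: "'o \<Rightarrow> 'a \<Rightarrow> 'a"
  assumes star_Hom: "\<lbrakk>X \<in> Obj C; \<alpha> \<in> kl_Hom C T X X\<rbrakk> \<Longrightarrow> star X \<alpha> \<in> kl_Hom C T X X"
    and star_refl: "\<lbrakk>X \<in> Obj C; \<alpha> \<in> kl_Hom C T X X\<rbrakk> \<Longrightarrow> kl_id T X \<sqsubseteq>\<^bsub>K X X\<^esub> star X \<alpha>"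
    and star_ext: "\<lbrakk>X \<in> Obj C; \<alpha> \<in> kl_Hom C T X X\<rbrakk> \<Longrightarrow> \<alpha> \<sqsubseteq>\<^bsub>K X X\<^esub> star X \<alpha>"
    and star_trans: "\<lbrakk>X \<in> Obj C; \<alpha> \<in> kl_Hom C T X X\<rbrakk>
          \<Longrightarrow> kl_comp C T X (star X \<alpha>) (star X \<alpha>) \<sqsubseteq>\<^bsub>K X X\<^esub> star X \<alpha>"
    and star_least: "\<lbrakk>X \<in> Obj C; \<alpha> \<in> kl_Hom C T X X; \<beta> \<in> kl_Hom C T X X;
          kl_id T X \<sqsubseteq>\<^bsub>K X X\<^esub> \<beta>; \<alpha> \<sqsubseteq>\<^bsub>K X X\<^esub> \<beta>; kl_comp C T X \<beta> \<beta> \<sqsubseteq>\<^bsub>K X X\<^esub> \<beta>\<rbrakk>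
          \<Longrightarrow> star X \<alpha> \<sqsubseteq>\<^bsub>K X X\<^esub> \<beta>"
    and star_sharp_le: "\<lbrakk>X \<in> Obj C; Y \<in> Obj C; f \<in> Hom C X Y;
          \<alpha> \<in> kl_Hom C T X X; \<beta> \<in> kl_Hom C T Y Y;
          kl_comp C T Y (sharp C T Y f) \<alpha> \<sqsubseteq>\<^bsub>K X Y\<^esub> kl_comp C T Y \<beta> (sharp C T Y f)\<rbrakk>
          \<Longrightarrow> kl_comp C T Y (sharp C T Y f) (star X \<alpha>)
              \<sqsubseteq>\<^bsub>K X Y\<^esub> kl_comp C T Y (star Y \<beta>) (sharp C T Y f)"
    and star_sharp_ge: "\<lbrakk>X \<in> Obj C; Y \<in> Obj C; f \<in> Hom C X Y;
          \<alpha> \<in> kl_Hom C T X X; \<beta> \<in> kl_Hom C T Y Y;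
          kl_comp C T Y \<beta> (sharp C T Y f) \<sqsubseteq>\<^bsub>K X Y\<^esub> kl_comp C T Y (sharp C T Y f) \<alpha>\<rbrakk>
          \<Longrightarrow> kl_comp C T Y (star Y \<beta>) (sharp C T Y f)
              \<sqsubseteq>\<^bsub>K X Y\<^esub> kl_comp C T Y (sharp C T Y f) (star X \<alpha>)"

text \<open>The empty set is included, so a bottom element is required.\<close>

definition has_finite_joins :: "'a gorder \<Rightarrow> bool"
  where "has_finite_joins L \<longleftrightarrow>
    (\<forall>A. finite A \<and> A \<subseteq> carrier L \<longrightarrow> (\<exists>s. least L s (Upper L A)))"

end

theory Submission
  imports Defs
begin

text \<open>The inequality \<open>f \<cdot> \<alpha> \<le> f\<close> reads \<open>f \<cdot> \<alpha> \<le> 1 \<cdot> f\<close>, so the saturation axiom for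
  arbitrary Kleisli arrows yields \<open>f \<cdot> \<alpha>\<^sup>* \<le> 1\<^sup>* \<cdot> f = f\<close>. This is the star induction rule of
  Kleene algebra: it makes \<open>g \<cdot> \<alpha>\<^sup>*\<close> the least prefixed point of \<open>x \<mapsto> g \<or> x \<cdot> \<alpha>\<close>,
  and a least prefixed point of a monotone map is its least fixed point.\<close>

lemma (in weak_partial_order) least_prefixed_point_imp_least_fixed_point:
  assumes mono: "Mono f" and closed: "f \<in> carrier L \<rightarrow> carrier L"
    and least: "least L s {x \<in> carrier L. f x \<sqsubseteq> x}"
  shows "least L s (fps L f)"
proof -
  have s: "s \<in> carrier L" and prefixed: "f s \<sqsubseteq> s" using least_mem[OF least] by auto
  have fs: "f s \<in> carrier L" using closed s by blast
  have "f (f s) \<sqsubseteq> f s" using use_iso1[OF mono fs s prefixed] .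
  then have "s \<sqsubseteq> f s" using least_le[OF least] fs by blast
  then have "f s .= s" using prefixed s fs by (intro weak_le_antisym)
  moreover have "s \<sqsubseteq> x" if "x \<in> fps L f" for x
  proof -
    have "x \<in> carrier L" "f x .= x" using that by (simp_all add: fps_def)
    then have "f x \<sqsubseteq> x" using closed by (auto intro: weak_refl)
    then show ?thesis using least_le[OF least] \<open>x \<in> carrier L\<close> by blast
  qed
  ultimately show ?thesis using s by (auto simp: least_def fps_def)
qed

lemma (in weak_upper_semilattice) join_le_iff:
  assumes "x \<in> carrier L" "y \<in> carrier L" "z \<in> carrier L"
  shows "x \<squnion> y \<sqsubseteq> z \<longleftrightarrow> x \<sqsubseteq> z \<and> y \<sqsubseteq> z"
  using assms by (meson join_closed join_le join_left join_right le_trans)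

lemma (in weak_upper_semilattice) isotone_join:
  assumes mono: "Mono f" and closed: "f \<in> carrier L \<rightarrow> carrier L" and a: "a \<in> carrier L"
  shows "Mono (\<lambda>x. a \<squnion> f x)"
proof (rule isotoneI)
  fix x y assume x: "x \<in> carrier L" and y: "y \<in> carrier L" and less_eq: "x \<sqsubseteq> y"
  have fx: "f x \<in> carrier L" and fy: "f y \<in> carrier L" using closed x y by auto
  have "f x \<sqsubseteq> f y" using use_iso1[OF mono x y less_eq] .
  also have "f y \<sqsubseteq> a \<squnion> f y" using a fy by (rule join_right)
  finally have "f x \<sqsubseteq> a \<squnion> f y" using a fx fy by simp
  then show "a \<squnion> f x \<sqsubseteq> a \<squnion> f y" using a fx fy by (simp add: join_le_iff join_left)
qed (fact weak_partial_order_axioms)+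

lemma has_finite_joins_imp_upper_semilattice:
  assumes "partial_order L" and "has_finite_joins L"
  shows "upper_semilattice L"
proof -
  interpret partial_order L by fact
  show ?thesis using assms(2) by unfold_locales (simp add: has_finite_joins_def)
qed

context order_enriched_monad
begin

lemma kl_comp_left_mono:
  assumes "X \<in> Obj C" "Y \<in> Obj C" "Z \<in> Obj C"
    and "f \<in> kl_Hom C T X Y" "f' \<in> kl_Hom C T X Y" "g \<in> kl_Hom C T Y Z"
    and "f \<sqsubseteq>\<^bsub>K X Y\<^esub> f'"
  shows "kl_comp C T Z g f \<sqsubseteq>\<^bsub>K X Z\<^esub> kl_comp C T Z g f'"
proof -
  interpret partial_order "K Y Z" using assms by (intro K_partial_order)
  show ?thesis using assms by (intro kl_comp_mono[of X Y Z]) (simp_all add: K_carrier)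
qed

lemma kl_comp_right_mono:
  assumes "X \<in> Obj C" "Y \<in> Obj C" "Z \<in> Obj C"
    and "f \<in> kl_Hom C T X Y" "g \<in> kl_Hom C T Y Z" "g' \<in> kl_Hom C T Y Z"
    and "g \<sqsubseteq>\<^bsub>K Y Z\<^esub> g'"
  shows "kl_comp C T Z g f \<sqsubseteq>\<^bsub>K X Z\<^esub> kl_comp C T Z g' f"
proof -
  interpret partial_order "K X Y" using assms by (intro K_partial_order)
  show ?thesis using assms by (intro kl_comp_mono[of X Y Z]) (simp_all add: K_carrier)
qed

lemma isotone_kl_comp_right:
  assumes X: "X \<in> Obj C" and Y: "Y \<in> Obj C" and Z: "Z \<in> Obj C" and f: "f \<in> kl_Hom C T X Y"
  shows "isotone (K Y Z) (K X Z) (\<lambda>g. kl_comp C T Z g f)"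
proof (rule isotoneI)
  show "weak_partial_order (K Y Z)" "weak_partial_order (K X Z)"
    using X Y Z by (simp_all add: K_partial_order partial_order.axioms(1))
qed (simp add: K_carrier X Y Z kl_comp_right_mono[OF X Y Z f])

end

context ordered_saturation_monad
begin

lemma star_kl_id:
  assumes X: "X \<in> Obj C"
  shows "star X (kl_id T X) = kl_id T X"
proof -
  interpret partial_order "K X X" using X by (intro K_partial_order)
  note id = kl_id_Hom[OF X]
  have "star X (kl_id T X) \<sqsubseteq>\<^bsub>K X X\<^esub> kl_id T X"
    using X id by (intro star_least) (simp_all add: K_carrier kl_comp_id)
  then show ?thesis
    using X id star_refl star_Hom by (intro le_antisym) (simp_all add: K_carrier)
qed

lemma star_comp_le_star:
  assumes X: "X \<in> Obj C" and \<alpha>: "\<alpha> \<in> kl_Hom C T X X"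
  shows "kl_comp C T X (star X \<alpha>) \<alpha> \<sqsubseteq>\<^bsub>K X X\<^esub> star X \<alpha>"
proof -
  interpret partial_order "K X X" using X by (intro K_partial_order)
  note star = star_Hom[OF X \<alpha>]
  have "kl_comp C T X (star X \<alpha>) \<alpha> \<sqsubseteq>\<^bsub>K X X\<^esub> kl_comp C T X (star X \<alpha>) (star X \<alpha>)"
    using X \<alpha> star star_ext by (intro kl_comp_left_mono)
  also have "\<dots> \<sqsubseteq>\<^bsub>K X X\<^esub> star X \<alpha>" using X \<alpha> by (rule star_trans)
  finally show ?thesis using X \<alpha> star by (simp add: K_carrier kl_comp_Hom)
qed

lemma le_kl_comp_star:
  assumes X: "X \<in> Obj C" and Y: "Y \<in> Obj C" and \<alpha>: "\<alpha> \<in> kl_Hom C T X X"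
    and g: "g \<in> kl_Hom C T X Y"
  shows "g \<sqsubseteq>\<^bsub>K X Y\<^esub> kl_comp C T Y g (star X \<alpha>)"
proof -
  have "kl_comp C T Y g (kl_id T X) \<sqsubseteq>\<^bsub>K X Y\<^esub> kl_comp C T Y g (star X \<alpha>)"
    using X Y \<alpha> g kl_id_Hom star_Hom star_refl by (intro kl_comp_left_mono)
  then show ?thesis using X Y g by (simp add: kl_comp_id)
qed

lemma kl_comp_star_comp_le:
  assumes X: "X \<in> Obj C" and Y: "Y \<in> Obj C" and \<alpha>: "\<alpha> \<in> kl_Hom C T X X"
    and g: "g \<in> kl_Hom C T X Y"
  shows "kl_comp C T Y (kl_comp C T Y g (star X \<alpha>)) \<alpha> \<sqsubseteq>\<^bsub>K X Y\<^esub> kl_comp C T Y g (star X \<alpha>)"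
proof -
  note star = star_Hom[OF X \<alpha>]
  have "kl_comp C T Y g (kl_comp C T X (star X \<alpha>) \<alpha>) \<sqsubseteq>\<^bsub>K X Y\<^esub> kl_comp C T Y g (star X \<alpha>)"
    using X Y \<alpha> g star kl_comp_Hom star_comp_le_star by (intro kl_comp_left_mono)
  then show ?thesis using kl_comp_assoc[OF X Y \<alpha> star g] by simp
qed

end

locale lax_uniform_saturation_monad = ordered_saturation_monad C T K star
  for C :: "('o, 'a) cat_data" and T :: "('o, 'a) monad_data" and K :: "'o \<Rightarrow> 'o \<Rightarrow> 'a gorder"
    and star :: "'o \<Rightarrow> 'a \<Rightarrow> 'a" +
  assumes star_lax_uniform: "\<lbrakk>X \<in> Obj C; Y \<in> Obj C;
      \<alpha> \<in> kl_Hom C T X X; f \<in> kl_Hom C T X Y; \<beta> \<in> kl_Hom C T Y Y;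
      kl_comp C T Y f \<alpha> \<sqsubseteq>\<^bsub>K X Y\<^esub> kl_comp C T Y \<beta> f\<rbrakk>
      \<Longrightarrow> kl_comp C T Y f (star X \<alpha>) \<sqsubseteq>\<^bsub>K X Y\<^esub> kl_comp C T Y (star Y \<beta>) f"
begin

lemma kl_comp_star_le:
  assumes X: "X \<in> Obj C" and Y: "Y \<in> Obj C" and \<alpha>: "\<alpha> \<in> kl_Hom C T X X"
    and f: "f \<in> kl_Hom C T X Y" and prefixed: "kl_comp C T Y f \<alpha> \<sqsubseteq>\<^bsub>K X Y\<^esub> f"
  shows "kl_comp C T Y f (star X \<alpha>) \<sqsubseteq>\<^bsub>K X Y\<^esub> f"
proof -
  have "kl_comp C T Y f (star X \<alpha>) \<sqsubseteq>\<^bsub>K X Y\<^esub> kl_comp C T Y (star Y (kl_id T Y)) f"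
    using X Y \<alpha> f kl_id_Hom prefixed by (intro star_lax_uniform) (simp_all add: kl_id_comp)
  then show ?thesis using X Y f by (simp add: star_kl_id kl_id_comp)
qed

lemma star_induct:
  assumes X: "X \<in> Obj C" and Y: "Y \<in> Obj C" and \<alpha>: "\<alpha> \<in> kl_Hom C T X X"
    and g: "g \<in> kl_Hom C T X Y" and f: "f \<in> kl_Hom C T X Y"
    and base: "g \<sqsubseteq>\<^bsub>K X Y\<^esub> f" and prefixed: "kl_comp C T Y f \<alpha> \<sqsubseteq>\<^bsub>K X Y\<^esub> f"
  shows "kl_comp C T Y g (star X \<alpha>) \<sqsubseteq>\<^bsub>K X Y\<^esub> f"
proof -
  interpret partial_order "K X Y" using X Y by (intro K_partial_order)
  note star = star_Hom[OF X \<alpha>]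
  have "kl_comp C T Y g (star X \<alpha>) \<sqsubseteq>\<^bsub>K X Y\<^esub> kl_comp C T Y f (star X \<alpha>)"
    using X Y star g f base by (intro kl_comp_right_mono)
  also have "\<dots> \<sqsubseteq>\<^bsub>K X Y\<^esub> f" using X Y \<alpha> f prefixed by (rule kl_comp_star_le)
  finally show ?thesis using X Y g f star by (simp add: K_carrier kl_comp_Hom[of Y _ X X])
qed

theorem kl_comp_star_least_fixed_point:
  assumes X: "X \<in> Obj C" and Y: "Y \<in> Obj C" and \<alpha>: "\<alpha> \<in> kl_Hom C T X X"
    and joins: "has_finite_joins (K X Y)" and g: "g \<in> kl_Hom C T X Y"
  shows "least (K X Y) (kl_comp C T Y g (star X \<alpha>))
           (fps (K X Y) (\<lambda>x. g \<squnion>\<^bsub>K X Y\<^esub> kl_comp C T Y x \<alpha>))"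
proof -
  interpret upper_semilattice "K X Y"
    using X Y joins by (intro has_finite_joins_imp_upper_semilattice K_partial_order)
  note carrier = K_carrier[OF X Y]
  let ?F = "\<lambda>x. g \<squnion>\<^bsub>K X Y\<^esub> kl_comp C T Y x \<alpha>"
  have closed: "(\<lambda>x. kl_comp C T Y x \<alpha>) \<in> carrier (K X Y) \<rightarrow> carrier (K X Y)"
    using kl_comp_Hom[OF Y \<alpha>] by (simp add: carrier)
  have prefixed_iff: "?F x \<sqsubseteq>\<^bsub>K X Y\<^esub> x \<longleftrightarrow> g \<sqsubseteq>\<^bsub>K X Y\<^esub> x \<and> kl_comp C T Y x \<alpha> \<sqsubseteq>\<^bsub>K X Y\<^esub> x"
    if "x \<in> carrier (K X Y)" for x
    using that g closed by (intro join_le_iff) (auto simp: carrier Pi_iff)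
  have "kl_comp C T Y g (star X \<alpha>) \<in> carrier (K X Y)"
    using kl_comp_Hom[OF Y star_Hom[OF X \<alpha>] g] by (simp add: carrier)
  then have "least (K X Y) (kl_comp C T Y g (star X \<alpha>)) {x \<in> carrier (K X Y). ?F x \<sqsubseteq>\<^bsub>K X Y\<^esub> x}"
    using le_kl_comp_star[OF X Y \<alpha> g] kl_comp_star_comp_le[OF X Y \<alpha> g] star_induct[OF X Y \<alpha> g]
    by (auto simp: least_def prefixed_iff carrier)
  moreover have "Mono\<^bsub>K X Y\<^esub> ?F"
    using X Y \<alpha> g closed by (intro isotone_join isotone_kl_comp_right) (simp_all add: carrier)
  moreover have "?F \<in> carrier (K X Y) \<rightarrow> carrier (K X Y)"
    using g closed by (simp add: Pi_iff flip: carrier)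
  ultimately show ?thesis by (intro least_prefixed_point_imp_least_fixed_point)
qed

end

theorem theorem5p2:
  fixes C :: "('o, 'a) cat_data"
    and T :: "('o, 'a) monad_data"
    and K :: "'o \<Rightarrow> 'o \<Rightarrow> 'a gorder"
    and star :: "'o \<Rightarrow> 'a \<Rightarrow> 'a"
    and X :: 'o
    and \<alpha> :: 'a
  assumes sat: "ordered_saturation_monad C T K star"
    and joins: "\<And>X Y. \<lbrakk>X \<in> Obj C; Y \<in> Obj C\<rbrakk> \<Longrightarrow> has_finite_joins (K X Y)"
    and star_le: "\<And>X Y \<alpha> f \<beta>.
      \<lbrakk>X \<in> Obj C; Y \<in> Obj C;
       \<alpha> \<in> kl_Hom C T X X; f \<in> kl_Hom C T X Y; \<beta> \<in> kl_Hom C T Y Y;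
       kl_comp C T Y f \<alpha> \<sqsubseteq>\<^bsub>K X Y\<^esub> kl_comp C T Y \<beta> f\<rbrakk>
      \<Longrightarrow> kl_comp C T Y f (star X \<alpha>) \<sqsubseteq>\<^bsub>K X Y\<^esub> kl_comp C T Y (star Y \<beta>) f"
    and star_ge: "\<And>X Y \<alpha> f \<beta>.
      \<lbrakk>X \<in> Obj C; Y \<in> Obj C;
       \<alpha> \<in> kl_Hom C T X X; f \<in> kl_Hom C T X Y; \<beta> \<in> kl_Hom C T Y Y;
       kl_comp C T Y \<beta> f \<sqsubseteq>\<^bsub>K X Y\<^esub> kl_comp C T Y f \<alpha>\<rbrakk>
      \<Longrightarrow> kl_comp C T Y (star Y \<beta>) f \<sqsubseteq>\<^bsub>K X Y\<^esub> kl_comp C T Y f (star X \<alpha>)"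
    and X: "X \<in> Obj C"
    and \<alpha>: "\<alpha> \<in> kl_Hom C T X X"
  shows "least (K X X) (star X \<alpha>)
           (fps (K X X) (\<lambda>x. kl_id T X \<squnion>\<^bsub>K X X\<^esub> kl_comp C T X x \<alpha>))"
proof -
  interpret lax_uniform_saturation_monad C T K star
    using sat star_le
    by (intro lax_uniform_saturation_monad.intro lax_uniform_saturation_monad_axioms.intro)
  have "kl_comp C T X (kl_id T X) (star X \<alpha>) = star X \<alpha>"
    using X \<alpha> star_Hom by (intro kl_id_comp)
  then show ?thesis
    using kl_comp_star_least_fixed_point[OF X X \<alpha> joins[OF X X] kl_id_Hom[OF X]] by simp
qed

end
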